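(* For every odd integer $m\ge 3$ and every integer $n\ge 3$ with $n\equiv 2\pmod 4$, there exists a Heffter array $H(m,n)$.
   Context: A (tight) Heffter array $H(m,n)$ is an $m\times n$ array with every cell filled by an element of $\mathbb{Z}_{2mn+1}$ such that every row and every column sums to $0$ modulo $2mn+1$, and no element of any pair $\{x,-x\}$ appears twice (using representatives $-mn,\dots,mn$, entries are nonzero and each of $1,\dots,mn$ appears exactly once up to sign). *)

theory Defs
  imports "HOL-Number_Theory.Cong"
begin

(* An m x n array over the integers modulo 2mn + 1 is a function on the cells
   (i, j) with i < m and j < n; its values elsewhere are irrelevant.  Each entry
   is given by its representative in -mn, ..., mn, so that x and -x are the two
   integers of the same absolute value. *)
definition heffter_array :: "nat \<Rightarrow> nat \<Rightarrow> (nat \<Rightarrow> nat \<Rightarrow> int) \<Rightarrow> bool" where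
  "heffter_array m n A \<longleftrightarrow>
     (\<forall>i<m. \<forall>j<n. A i j \<in> {- int (m * n)..int (m * n)} \<and> A i j \<noteq> 0) \<and>
     (\<forall>k\<in>{1..int (m * n)}. \<exists>!p. p \<in> {..<m} \<times> {..<n} \<and> \<bar>A (fst p) (snd p)\<bar> = k) \<and>
     (\<forall>i<m. [(\<Sum>j<n. A i j) = 0] (mod int (2 * m * n + 1))) \<and>
     (\<forall>j<n. [(\<Sum>i<m. A i j) = 0] (mod int (2 * m * n + 1)))"

end

theory Submission
  imports Defs
begin

text \<open>
  Write \<open>n = 6 + 4 s\<close>, \<open>m = 3 + 4 t\<close> or \<open>m = 5 + 4 t\<close>, and \<open>M = mn\<close>.  The top 3 or 5 rows
  consist of one sporadic block with 6 columns and of \<open>s\<close> blocks with 4 columns, all of which have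
  row and column sums \<open>0\<close> or \<open>\<plusminus>(2M + 1)\<close>.  The entries of the \<open>k\<close>-th block are linear in \<open>k\<close>, so that
  each family of entries sweeps out an interval, as in the construction of Skolem sequences: a
  column with entries \<open>u + k\<close>, \<open>-(v - k)\<close> and \<open>-(u - v + 2 k)\<close> has sum 0.  The entries of the sporadic
  block fill the gaps, and only one interval of length \<open>4 t n\<close> is left over.  The remaining \<open>4 t\<close>
  rows are tiled by zero-sum \<open>4 \<times> 4\<close> and \<open>4 \<times> 6\<close> arrays on consecutive integers with as
  many positive as negative entries in each line, so that they can be shifted freely.
\<close>

section \<open>Gluing arrays with zero line sums, and the passage to Heffter arrays\<close>

text \<open>Only covering is required, since an array with \<open>mn\<close> cells that covers \<open>1, \<dots>, mn\<close> up to sign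
  covers each of them once.  Thus no disjointness has to be tracked when arrays are glued.\<close>

definition zero_sum_covers :: "int \<Rightarrow> nat \<Rightarrow> nat \<Rightarrow> int set \<Rightarrow> bool" where
  "zero_sum_covers N m n S \<longleftrightarrow>
     (\<exists>A. (\<forall>i<m. N dvd (\<Sum>j<n. A i j)) \<and> (\<forall>j<n. N dvd (\<Sum>i<m. A i j)) \<and>
          (\<forall>x\<in>S. \<exists>i<m. \<exists>j<n. A i j = x \<or> A i j = - x))"

lemma zero_sum_covers_mono:
  "zero_sum_covers N m n S \<Longrightarrow> T \<subseteq> S \<Longrightarrow> zero_sum_covers N m n T"
  unfolding zero_sum_covers_def by (elim ex_forward) blast

lemma zero_sum_covers_transpose:
  assumes "zero_sum_covers N m n S"
  shows "zero_sum_covers N n m S"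
proof -
  obtain A where "\<forall>i<m. N dvd (\<Sum>j<n. A i j)" "\<forall>j<n. N dvd (\<Sum>i<m. A i j)"
    "\<forall>x\<in>S. \<exists>i<m. \<exists>j<n. A i j = x \<or> A i j = - x"
    using assms unfolding zero_sum_covers_def by blast
  then show ?thesis
    unfolding zero_sum_covers_def by (intro exI[of _ "\<lambda>i j. A j i"]) blast
qed

lemma zero_sum_covers_empty: "zero_sum_covers N m 0 {}"
  unfolding zero_sum_covers_def by simp

lemma sum_if_append:
  fixes f g :: "nat \<Rightarrow> int"
  shows "(\<Sum>j<n + n'. if j < n then f j else g (j - n)) = (\<Sum>j<n. f j) + (\<Sum>j<n'. g j)"
  by (induction n') simp_all

lemma zero_sum_covers_append:
  assumes "zero_sum_covers N m n S" "zero_sum_covers N m n' T"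
  shows "zero_sum_covers N m (n + n') (S \<union> T)"
proof -
  obtain A where A: "\<forall>i<m. N dvd (\<Sum>j<n. A i j)" "\<forall>j<n. N dvd (\<Sum>i<m. A i j)"
    "\<forall>x\<in>S. \<exists>i<m. \<exists>j<n. A i j = x \<or> A i j = - x"
    using assms(1) unfolding zero_sum_covers_def by blast
  obtain B where B: "\<forall>i<m. N dvd (\<Sum>j<n'. B i j)" "\<forall>j<n'. N dvd (\<Sum>i<m. B i j)"
    "\<forall>x\<in>T. \<exists>i<m. \<exists>j<n'. B i j = x \<or> B i j = - x"
    using assms(2) unfolding zero_sum_covers_def by blast
  define C where "C i j = (if j < n then A i j else B i (j - n))" for i j
  have "\<forall>i<m. N dvd (\<Sum>j<n + n'. C i j)"
    unfolding C_def sum_if_append using A(1) B(1) by simp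
  moreover have "N dvd (\<Sum>i<m. C i j)" if "j < n + n'" for j
    using A(2) B(2) that by (cases "j < n") (simp_all add: C_def)
  moreover have "\<exists>i<m. \<exists>j<n + n'. C i j = x \<or> C i j = - x" if x: "x \<in> S \<union> T" for x
  proof (cases "x \<in> S")
    case True
    then obtain i j where "i < m" "j < n" "A i j = x \<or> A i j = - x"
      using A(3) by blast
    then show ?thesis
      by (intro exI[of _ i] exI[of _ j] conjI) (auto simp: C_def)
  next
    case False
    then obtain i j where "i < m" "j < n'" "B i j = x \<or> B i j = - x"
      using B(3) x by blast
    then show ?thesis
      by (intro exI[of _ i] exI[of _ "n + j"] conjI) (auto simp: C_def)
  qed
  ultimately show ?thesis
    unfolding zero_sum_covers_def by blast
qed

lemma zero_sum_covers_concat: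
  assumes "\<And>k. k < s \<Longrightarrow> zero_sum_covers N m n (S k)"
  shows "zero_sum_covers N m (s * n) (\<Union>k<s. S k)"
  using assms
proof (induction s)
  case 0
  then show ?case by (simp add: zero_sum_covers_empty)
next
  case (Suc s)
  then have "zero_sum_covers N m (s * n + n) ((\<Union>k<s. S k) \<union> S s)"
    by (intro zero_sum_covers_append) auto
  then show ?case
    by (simp add: lessThan_Suc add.commute Un_commute)
qed

text \<open>Interface for explicit matrices. Asking for sums in \<open>{- N, 0, N}\<close> instead
  of divisibility by \<open>N\<close> turns each line condition into a linear identity in the
  symbolic entries, which simplification decides.\<close>

lemma zero_sum_covers_list:
  assumes "length xss = m"
    and "\<forall>xs\<in>set xss. length xs = n \<and> sum_list xs \<in> {- N, 0, N}"
    and "\<forall>j<n. sum_list (map (\<lambda>xs. xs ! j) xss) \<in> {- N, 0, N}"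
    and "S = {x. \<exists>xs\<in>set xss. x \<in> set xs \<or> - x \<in> set xs}"
  shows "zero_sum_covers N m n S"
proof -
  have "N dvd (\<Sum>j<n. xss ! i ! j)" if "i < m" for i
  proof -
    have "xss ! i \<in> set xss" using that assms(1) by simp
    then have "length (xss ! i) = n" "sum_list (xss ! i) \<in> {- N, 0, N}"
      using assms(2) by blast+
    then show ?thesis
      by (auto simp: sum_list_sum_nth atLeast0LessThan)
  qed
  moreover have "N dvd (\<Sum>i<m. xss ! i ! j)" if "j < n" for j
  proof -
    have "sum_list (map (\<lambda>xs. xs ! j) xss) = (\<Sum>i<m. xss ! i ! j)"
      using assms(1) by (simp add: sum_list_sum_nth atLeast0LessThan)
    then show ?thesis
      using assms(3) that by (metis dvd_0_right dvd_minus_iff dvd_refl empty_iff insert_iff)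
  qed
  moreover have "\<exists>i<m. \<exists>j<n. xss ! i ! j = x \<or> xss ! i ! j = - x" if "x \<in> S" for x
  proof -
    obtain xs where xs: "xs \<in> set xss" "x \<in> set xs \<or> - x \<in> set xs"
      using \<open>x \<in> S\<close> assms(4) by blast
    then obtain j where "j < n" "xs ! j = x \<or> xs ! j = - x"
      using assms(2) by (metis in_set_conv_nth)
    moreover obtain i where "i < m" "xss ! i = xs"
      using xs(1) assms(1) by (metis in_set_conv_nth)
    ultimately show ?thesis by blast
  qed
  ultimately show ?thesis
    unfolding zero_sum_covers_def by (intro exI[of _ "\<lambda>i j. xss ! i ! j"]) blast
qed

text \<open>A counting argument: the absolute values map \<open>m * n\<close> cells onto a superset
  of a set with \<open>m * n\<close> elements, so this map is injective and its image is exactly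
  \<open>{1..int (m * n)}\<close>. Injectivity gives uniqueness, and the image gives the bounds and
  nonzero entries.\<close>

lemma heffter_array_if_zero_sum_covers:
  assumes "zero_sum_covers (2 * int (m * n) + 1) m n {1..int (m * n)}"
  shows "\<exists>A. heffter_array m n A"
proof -
  define M where "M = int (m * n)"
  obtain A where row: "\<forall>i<m. 2 * M + 1 dvd (\<Sum>j<n. A i j)"
    and col: "\<forall>j<n. 2 * M + 1 dvd (\<Sum>i<m. A i j)"
    and cov: "\<forall>x\<in>{1..M}. \<exists>i<m. \<exists>j<n. A i j = x \<or> A i j = - x"
    using assms unfolding zero_sum_covers_def M_def by blast
  define g where "g p = \<bar>A (fst p) (snd p)\<bar>" for p
  let ?P = "{..<m} \<times> {..<n}"
  have sub: "{1..M} \<subseteq> g ` ?P"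
  proof
    fix x assume x: "x \<in> {1..M}"
    then obtain i j where "i < m" "j < n" "A i j = x \<or> A i j = - x"
      using cov by blast
    then show "x \<in> g ` ?P"
      using x by (intro image_eqI[of _ _ "(i, j)"]) (auto simp: g_def)
  qed
  have card: "card ?P = card {1..M}"
    by (simp add: M_def nat_mult_distrib)
  have "card {1..M} \<le> card (g ` ?P)"
    using sub by (intro card_mono) auto
  moreover have "card (g ` ?P) \<le> card ?P"
    by (intro card_image_le) auto
  ultimately have eq: "card (g ` ?P) = card ?P"
    using card by simp
  then have inj: "inj_on g ?P"
    by (intro eq_card_imp_inj_on) auto
  have img: "g ` ?P = {1..M}"
    using card_subset_eq[OF _ sub] eq card by simp
  have "A i j \<in> {- M..M} \<and> A i j \<noteq> 0" if "i < m" "j < n" for i j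
  proof -
    have "g (i, j) \<in> {1..M}"
      using that img by blast
    then show ?thesis by (auto simp: g_def)
  qed
  moreover have "\<exists>!p. p \<in> ?P \<and> \<bar>A (fst p) (snd p)\<bar> = k" if "k \<in> {1..M}" for k
  proof -
    have "k \<in> g ` ?P"
      using that img by simp
    then obtain p where "p \<in> ?P" "g p = k"
      by blast
    then show ?thesis
      using inj unfolding g_def[symmetric] by (intro ex1I[of _ p]) (blast dest: inj_onD)+
  qed
  moreover have modulus: "int (2 * m * n + 1) = 2 * M + 1"
    by (simp add: M_def)
  ultimately have "heffter_array m n A"
    using row col unfolding heffter_array_def M_def[symmetric] cong_0_iff modulus by blast
  then show ?thesis by blast
qed

section \<open>Assembling intervals from families of entries\<close>

lemma interval_subset_Union_intervals:
  fixes x c :: int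
  assumes "c > 0"
  shows "{x..<x + c * int s} \<subseteq> (\<Union>k<s. {x + c * int k..<x + c * int k + c})"
proof
  fix y assume y: "y \<in> {x..<x + c * int s}"
  \<comment> \<open>The index of the piece of length \<open>c\<close> that contains
    \<open>y\<close>.\<close>
  define k where "k = nat ((y - x) div c)"
  have k: "int k = (y - x) div c"
    using y assms by (simp add: k_def pos_imp_zdiv_nonneg_iff)
  have "y - x = c * int k + (y - x) mod c"
    unfolding k by simp
  moreover have "0 \<le> (y - x) mod c" "(y - x) mod c < c"
    using assms by simp_all
  moreover from calculation have "c * int k < c * int s"
    using y unfolding atLeastLessThan_iff by linarith
  then have "k < s"
    using assms by simp
  ultimately show "y \<in> (\<Union>k<s. {x + c * int k..<x + c * int k + c})"
    by (intro UN_I[of k]) auto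
qed

lemma interval_subset_points:
  fixes a b :: int
  assumes "b = a + int n" "(\<lambda>d. a + int d) ` {..<n} \<subseteq> U"
  shows "{a..<b} \<subseteq> U"
proof
  fix x assume "x \<in> {a..<b}"
  then have "x = a + int (nat (x - a))" "nat (x - a) < n"
    using assms(1) by auto
  then show "x \<in> U"
    using assms(2) by (metis imageI lessThan_iff subsetD)
qed

text \<open>For families in which each block supplies the next \<open>c\<close> integers. With a
  concrete \<open>c\<close>, the last hypothesis is a finite list of membership checks.\<close>

lemma interval_subset_Union_ascending:
  fixes a b :: int
  assumes "b = a + int (c * s)" "c > 0"
    and "\<And>k. k < s \<Longrightarrow> (\<lambda>d. a + int c * int k + int d) ` {..<c} \<subseteq> B k"
  shows "{a..<b} \<subseteq> (\<Union>k<s. B k)"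
proof -
  have "{a + int c * int k..<a + int c * int k + int c} \<subseteq> B k" if "k < s" for k
    using assms(3)[OF that] by (rule interval_subset_points[OF refl])
  then have "(\<Union>k<s. {a + int c * int k..<a + int c * int k + int c}) \<subseteq> (\<Union>k<s. B k)"
    by (intro UN_mono) auto
  moreover have "{a..<b} \<subseteq> (\<Union>k<s. {a + int c * int k..<a + int c * int k + int c})"
    using interval_subset_Union_intervals[of "int c" a s] assms(1,2) by simp
  ultimately show ?thesis
    by (rule order_trans[rotated])
qed

text \<open>For entries that decrease as \<open>k\<close> grows: block 0 supplies the largest point
  \<open>b - 1\<close>, and each later block the point just below.\<close>

lemma interval_subset_Union_descending:
  fixes a b :: int
  assumes "b = a + int s" "\<And>k. k < s \<Longrightarrow> b - 1 - int k \<in> B k"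
  shows "{a..<b} \<subseteq> (\<Union>k<s. B k)"
proof
  fix x assume x: "x \<in> {a..<b}"
  then have "nat (b - 1 - x) < s"
    using assms(1) by auto
  then show "x \<in> (\<Union>k<s. B k)"
    using assms(2)[of "nat (b - 1 - x)"] x by auto
qed

text \<open>As a transitivity rule, this lets an \<open>also\<close> chain walk through adjacent
  intervals inside one fixed set \<open>U\<close>.\<close>

lemma interval_append [trans]:
  fixes a b c :: "'a::linorder"
  shows "{a..<b} \<subseteq> U \<Longrightarrow> {b..<c} \<subseteq> U \<Longrightarrow> {a..<c} \<subseteq> U"
  by (auto simp: subset_eq)

section \<open>Shiftable arrays with four rows\<close>

text \<open>Two entries of each sign in every line make \<open>x\<close> cancel; the sums are
  exactly 0, so the modulus \<open>N\<close> is arbitrary.\<close>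

lemma zero_sum_covers_4_4: "zero_sum_covers N 4 4 {x..<x + 16}"
proof (rule zero_sum_covers_mono[OF zero_sum_covers_list[OF _ _ _ refl]])
  let ?xss = "[[x + 13, - (x + 15), x + 6, - (x + 4)],
    [- (x + 12), x + 14, - (x + 7), x + 5],
    [- (x + 9), x + 1, - (x + 2), x + 10],
    [x + 8, - x, x + 3, - (x + 11)]]"
  show "length ?xss = 4" by simp
  show "\<forall>xs\<in>set ?xss. length xs = 4 \<and> sum_list xs \<in> {- N, 0, N}" by simp
  show "\<forall>j<4. sum_list (map (\<lambda>xs. xs ! j) ?xss) \<in> {- N, 0, N}"
    by (simp add: numeral_eq_Suc All_less_Suc)
  show "{x..<x + 16} \<subseteq> {y. \<exists>xs\<in>set ?xss. y \<in> set xs \<or> - y \<in> set xs}"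
    by (rule interval_subset_points[of _ _ 16]) (simp_all add: lessThan_nat_numeral lessThan_Suc)
qed

lemma zero_sum_covers_4_6: "zero_sum_covers N 4 6 {x..<x + 24}"
proof (rule zero_sum_covers_mono[OF zero_sum_covers_list[OF _ _ _ refl]])
  let ?xss = "[[- (x + 17), x + 10, - (x + 18), x + 12, x + 20, - (x + 7)],
    [x + 16, x + 15, - (x + 3), - (x + 13), - (x + 21), x + 6],
    [x + 1, - (x + 14), x + 2, - (x + 4), - (x + 8), x + 23],
    [- x, - (x + 11), x + 19, x + 5, x + 9, - (x + 22)]]"
  show "length ?xss = 4" by simp
  show "\<forall>xs\<in>set ?xss. length xs = 6 \<and> sum_list xs \<in> {- N, 0, N}" by simp
  show "\<forall>j<6. sum_list (map (\<lambda>xs. xs ! j) ?xss) \<in> {- N, 0, N}"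
    by (simp add: numeral_eq_Suc All_less_Suc)
  show "{x..<x + 24} \<subseteq> {y. \<exists>xs\<in>set ?xss. y \<in> set xs \<or> - y \<in> set xs}"
    by (rule interval_subset_points[of _ _ 24]) (simp_all add: lessThan_nat_numeral lessThan_Suc)
qed

section \<open>The top three or five rows\<close>

text \<open>The matrices below were found by computer search.  The leftover interval is the gap between
  the two covered ones; its length is determined by \<open>M\<close>.\<close>

lemma zero_sum_covers_3_rows:
  "zero_sum_covers (2 * M + 1) 3 (6 + s * 4)
    ({1..<8 * int s + 11} \<union> {M - 4 * int s - 7..<M + 1})"
proof (rule zero_sum_covers_mono)
  let ?s = "int s"
  \<comment> \<open>All line sums are identities in \<open>M\<close> and \<open>?s\<close>. Only in
    row 1 and columns 4, 5 and 6 do the occurrences of \<open>M\<close> fail to cancel; these sums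
    are \<plusminus>(2M + 1).\<close>
  let ?core =
      "[[2 * ?s + 1, 4 * ?s + 5, M - 3 * ?s - 4, - (7 * ?s + 8), 7 * ?s + 9, M - 3 * ?s - 2],
       [4 * ?s + 6, - (2 * ?s + 2), - (M - ?s), - (M - 4 * ?s - 6), M - 3 * ?s - 3, M - 4 * ?s - 7],
       [- (6 * ?s + 7), - (2 * ?s + 3), 2 * ?s + 4, - (M - 3 * ?s - 1), M - 4 * ?s - 5, 7 * ?s + 10]]"
  \<comment> \<open>Here all line sums are 0. The first row supplies two pairs of consecutive
    integers; the absolute value of each of the other eight entries moves by one with
    \<open>k\<close> and sweeps out an interval of length \<open>?s\<close>.\<close>
  let ?block =
      "\<lambda>k. [[2 * k + 2, - (2 * k + 1), 2 * ?s + 2 * k + 5, - (2 * ?s + 2 * k + 6)],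
       [6 * ?s - k + 6, M - 2 * ?s + k, - (7 * ?s + k + 11), - (M - 3 * ?s - k - 5)],
       [- (6 * ?s + k + 8), - (M - 2 * ?s - k - 1), 5 * ?s - k + 6, M - ?s + k + 1]]"
  define C where "C = {x. \<exists>xs\<in>set ?core. x \<in> set xs \<or> - x \<in> set xs}"
  define B where "B k = {x. \<exists>xs\<in>set (?block (int k)). x \<in> set xs \<or> - x \<in> set xs}" for k
  have "zero_sum_covers (2 * M + 1) 3 6 C"
    by (rule zero_sum_covers_list[OF _ _ _ C_def]) (simp_all add: numeral_eq_Suc All_less_Suc)
  moreover have "zero_sum_covers (2 * M + 1) 3 4 (B k)" for k
    by (rule zero_sum_covers_list[OF _ _ _ B_def]) (simp_all add: numeral_eq_Suc All_less_Suc)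
  ultimately show "zero_sum_covers (2 * M + 1) 3 (6 + s * 4) (C \<union> (\<Union>k<s. B k))"
    by (intro zero_sum_covers_append zero_sum_covers_concat)
  show "{1..<8 * ?s + 11} \<union> {M - 4 * ?s - 7..<M + 1} \<subseteq> C \<union> (\<Union>k<s. B k)"
    (is "_ \<subseteq> ?U")
  proof (rule Un_least)
    \<comment> \<open>The chain goes from left to right: \<open>le_supI2\<close> selects a family
      swept out by the blocks, \<open>le_supI1\<close> a short gap filled by the core.\<close>
    have "{1..<2 * ?s + 1} \<subseteq> ?U"
      by (rule le_supI2, rule interval_subset_Union_ascending[of _ _ 2])
        (simp_all add: B_def lessThan_nat_numeral lessThan_Suc)
    also have "{2 * ?s + 1..<2 * ?s + 5} \<subseteq> ?U"
      by (rule le_supI1, rule interval_subset_points[of _ _ 4])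
        (simp_all add: C_def lessThan_nat_numeral lessThan_Suc)
    also have "{2 * ?s + 5..<4 * ?s + 5} \<subseteq> ?U"
      by (rule le_supI2, rule interval_subset_Union_ascending[of _ _ 2])
        (simp_all add: B_def lessThan_nat_numeral lessThan_Suc)
    also have "{4 * ?s + 5..<4 * ?s + 7} \<subseteq> ?U"
      by (rule le_supI1, rule interval_subset_points[of _ _ 2])
        (simp_all add: C_def lessThan_nat_numeral lessThan_Suc)
    also have "{4 * ?s + 7..<5 * ?s + 7} \<subseteq> ?U"
      by (rule le_supI2, rule interval_subset_Union_descending) (simp_all add: B_def)
    also have "{5 * ?s + 7..<6 * ?s + 7} \<subseteq> ?U"
      by (rule le_supI2, rule interval_subset_Union_descending) (simp_all add: B_def)
    also have "{6 * ?s + 7..<6 * ?s + 8} \<subseteq> ?U"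
      by (rule le_supI1, rule interval_subset_points[of _ _ 1])
        (simp_all add: C_def lessThan_nat_numeral lessThan_Suc)
    also have "{6 * ?s + 8..<7 * ?s + 8} \<subseteq> ?U"
      by (rule le_supI2, rule interval_subset_Union_ascending[of _ _ 1])
        (simp_all add: B_def lessThan_nat_numeral lessThan_Suc)
    also have "{7 * ?s + 8..<7 * ?s + 11} \<subseteq> ?U"
      by (rule le_supI1, rule interval_subset_points[of _ _ 3])
        (simp_all add: C_def lessThan_nat_numeral lessThan_Suc)
    also have "{7 * ?s + 11..<8 * ?s + 11} \<subseteq> ?U"
      by (rule le_supI2, rule interval_subset_Union_ascending[of _ _ 1])
        (simp_all add: B_def lessThan_nat_numeral lessThan_Suc)
    finally show "{1..<8 * ?s + 11} \<subseteq> ?U" .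
    \<comment> \<open>The upper interval consists of the absolute values of the entries that involve
      \<open>M\<close>.\<close>
    have "{M - 4 * ?s - 7..<M - 4 * ?s - 4} \<subseteq> ?U"
      by (rule le_supI1, rule interval_subset_points[of _ _ 3])
        (simp_all add: C_def lessThan_nat_numeral lessThan_Suc)
    also have "{M - 4 * ?s - 4..<M - 3 * ?s - 4} \<subseteq> ?U"
      by (rule le_supI2, rule interval_subset_Union_descending) (simp_all add: B_def)
    also have "{M - 3 * ?s - 4..<M - 3 * ?s} \<subseteq> ?U"
      by (rule le_supI1, rule interval_subset_points[of _ _ 4])
        (simp_all add: C_def lessThan_nat_numeral lessThan_Suc)
    also have "{M - 3 * ?s..<M - 2 * ?s} \<subseteq> ?U"
      by (rule le_supI2, rule interval_subset_Union_descending) (simp_all add: B_def)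
    also have "{M - 2 * ?s..<M - ?s} \<subseteq> ?U"
      by (rule le_supI2, rule interval_subset_Union_ascending[of _ _ 1])
        (simp_all add: B_def lessThan_nat_numeral lessThan_Suc)
    also have "{M - ?s..<M - ?s + 1} \<subseteq> ?U"
      by (rule le_supI1, rule interval_subset_points[of _ _ 1])
        (simp_all add: C_def lessThan_nat_numeral lessThan_Suc)
    also have "{M - ?s + 1..<M + 1} \<subseteq> ?U"
      by (rule le_supI2, rule interval_subset_Union_ascending[of _ _ 1])
        (simp_all add: B_def lessThan_nat_numeral lessThan_Suc)
    finally show "{M - 4 * ?s - 7..<M + 1} \<subseteq> ?U" .
  qed
qed

text \<open>Rows 4 and 5 use up consecutive integers; in each column their two entries have opposite signs
  and contribute only a small constant, which shifts the differences in the first three rows.\<close>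

lemma zero_sum_covers_5_rows:
  "zero_sum_covers (2 * M + 1) 5 (6 + s * 4)
    ({1..<16 * int s + 25} \<union> {M - 4 * int s - 5..<M + 1})"
proof (rule zero_sum_covers_mono)
  let ?s = "int s"
  let ?core =
      "[[1, 4 * ?s + 7, - (6 * ?s + 10), 2 * ?s + 4, M - 3 * ?s - 5, - (M - 3 * ?s - 3)],
       [- (4 * ?s + 5), - (6 * ?s + 11), 4 * ?s + 6, M - ?s - 2, 4 * ?s + 8, - (M - 3 * ?s - 4)],
       [4 * ?s + 9, 2 * ?s + 2, 2 * ?s + 3, M - ?s, M - ?s - 1, - (6 * ?s + 12)],
       [- (8 * ?s + 19), 8 * ?s + 15, - (8 * ?s + 17), - (8 * ?s + 22), 8 * ?s + 23, 8 * ?s + 20],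
       [8 * ?s + 14, - (8 * ?s + 13), 8 * ?s + 18, 8 * ?s + 21, - (8 * ?s + 24), - (8 * ?s + 16)]]"
  \<comment> \<open>In each block, rows 4 and 5 use the next eight integers and add 1, 1, -1, -1 to
    the four columns, so the first three rows have column sums -1, -1, 1, 1.\<close>
  let ?block =
      "\<lambda>k. [[2 * k + 3, - (2 * k + 2), 2 * ?s + 2 * k + 5, - (2 * ?s + 2 * k + 6)],
       [6 * ?s - k + 9, - (M - 2 * ?s - k - 3), - (7 * ?s + k + 13), M - ?s + k + 1],
       [- (6 * ?s + k + 13), M - 2 * ?s + k - 2, 5 * ?s - k + 9, - (M - 3 * ?s - k - 6)],
       [8 * ?s + 8 * k + 26, - (8 * ?s + 8 * k + 27), - (8 * ?s + 8 * k + 30), 8 * ?s + 8 * k + 31],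
       [- (8 * ?s + 8 * k + 25), 8 * ?s + 8 * k + 28, 8 * ?s + 8 * k + 29, - (8 * ?s + 8 * k + 32)]]"
  define C where "C = {x. \<exists>xs\<in>set ?core. x \<in> set xs \<or> - x \<in> set xs}"
  define B where "B k = {x. \<exists>xs\<in>set (?block (int k)). x \<in> set xs \<or> - x \<in> set xs}" for k
  have "zero_sum_covers (2 * M + 1) 5 6 C"
    by (rule zero_sum_covers_list[OF _ _ _ C_def]) (simp_all add: numeral_eq_Suc All_less_Suc)
  moreover have "zero_sum_covers (2 * M + 1) 5 4 (B k)" for k
    by (rule zero_sum_covers_list[OF _ _ _ B_def]) (simp_all add: numeral_eq_Suc All_less_Suc)
  ultimately show "zero_sum_covers (2 * M + 1) 5 (6 + s * 4) (C \<union> (\<Union>k<s. B k))"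
    by (intro zero_sum_covers_append zero_sum_covers_concat)
  show "{1..<16 * ?s + 25} \<union> {M - 4 * ?s - 5..<M + 1} \<subseteq> C \<union> (\<Union>k<s. B k)"
    (is "_ \<subseteq> ?U")
  proof (rule Un_least)
    \<comment> \<open>The core takes 1, so the pairs in the first row of the blocks start at
      2.\<close>
    have "{1..<2} \<subseteq> ?U"
      by (rule le_supI1, rule interval_subset_points[of _ _ 1])
        (simp_all add: C_def lessThan_nat_numeral lessThan_Suc)
    also have "{2..<2 * ?s + 2} \<subseteq> ?U"
      by (rule le_supI2, rule interval_subset_Union_ascending[of _ _ 2])
        (simp_all add: B_def lessThan_nat_numeral lessThan_Suc)
    also have "{2 * ?s + 2..<2 * ?s + 5} \<subseteq> ?U"
      by (rule le_supI1, rule interval_subset_points[of _ _ 3])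
        (simp_all add: C_def lessThan_nat_numeral lessThan_Suc)
    also have "{2 * ?s + 5..<4 * ?s + 5} \<subseteq> ?U"
      by (rule le_supI2, rule interval_subset_Union_ascending[of _ _ 2])
        (simp_all add: B_def lessThan_nat_numeral lessThan_Suc)
    also have "{4 * ?s + 5..<4 * ?s + 10} \<subseteq> ?U"
      by (rule le_supI1, rule interval_subset_points[of _ _ 5])
        (simp_all add: C_def lessThan_nat_numeral lessThan_Suc)
    also have "{4 * ?s + 10..<5 * ?s + 10} \<subseteq> ?U"
      by (rule le_supI2, rule interval_subset_Union_descending) (simp_all add: B_def)
    also have "{5 * ?s + 10..<6 * ?s + 10} \<subseteq> ?U"
      by (rule le_supI2, rule interval_subset_Union_descending) (simp_all add: B_def)
    also have "{6 * ?s + 10..<6 * ?s + 13} \<subseteq> ?U"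
      by (rule le_supI1, rule interval_subset_points[of _ _ 3])
        (simp_all add: C_def lessThan_nat_numeral lessThan_Suc)
    also have "{6 * ?s + 13..<7 * ?s + 13} \<subseteq> ?U"
      by (rule le_supI2, rule interval_subset_Union_ascending[of _ _ 1])
        (simp_all add: B_def lessThan_nat_numeral lessThan_Suc)
    also have "{7 * ?s + 13..<8 * ?s + 13} \<subseteq> ?U"
      by (rule le_supI2, rule interval_subset_Union_ascending[of _ _ 1])
        (simp_all add: B_def lessThan_nat_numeral lessThan_Suc)
    also have "{8 * ?s + 13..<8 * ?s + 25} \<subseteq> ?U"
      by (rule le_supI1, rule interval_subset_points[of _ _ 12])
        (simp_all add: C_def lessThan_nat_numeral lessThan_Suc)
    also have "{8 * ?s + 25..<16 * ?s + 25} \<subseteq> ?U"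
      by (rule le_supI2, rule interval_subset_Union_ascending[of _ _ 8])
        (simp_all add: B_def lessThan_nat_numeral lessThan_Suc)
    finally show "{1..<16 * ?s + 25} \<subseteq> ?U" .
    have "{M - 4 * ?s - 5..<M - 3 * ?s - 5} \<subseteq> ?U"
      by (rule le_supI2, rule interval_subset_Union_descending) (simp_all add: B_def)
    also have "{M - 3 * ?s - 5..<M - 3 * ?s - 2} \<subseteq> ?U"
      by (rule le_supI1, rule interval_subset_points[of _ _ 3])
        (simp_all add: C_def lessThan_nat_numeral lessThan_Suc)
    also have "{M - 3 * ?s - 2..<M - 2 * ?s - 2} \<subseteq> ?U"
      by (rule le_supI2, rule interval_subset_Union_descending) (simp_all add: B_def)
    also have "{M - 2 * ?s - 2..<M - ?s - 2} \<subseteq> ?U"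
      by (rule le_supI2, rule interval_subset_Union_ascending[of _ _ 1])
        (simp_all add: B_def lessThan_nat_numeral lessThan_Suc)
    also have "{M - ?s - 2..<M - ?s + 1} \<subseteq> ?U"
      by (rule le_supI1, rule interval_subset_points[of _ _ 3])
        (simp_all add: C_def lessThan_nat_numeral lessThan_Suc)
    also have "{M - ?s + 1..<M + 1} \<subseteq> ?U"
      by (rule le_supI2, rule interval_subset_Union_ascending[of _ _ 1])
        (simp_all add: B_def lessThan_nat_numeral lessThan_Suc)
    finally show "{M - 4 * ?s - 5..<M + 1} \<subseteq> ?U" .
  qed
qed

section \<open>Filling the remaining rows\<close>

lemma zero_sum_covers_4_row:
  "zero_sum_covers N 4 (6 + s * 4) {x..<x + (24 + 16 * int s)}"
proof (rule zero_sum_covers_mono)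
  show "zero_sum_covers N 4 (6 + s * 4)
    ({x..<x + 24} \<union> (\<Union>k<s. {x + 24 + 16 * int k..<x + 24 + 16 * int k + 16}))"
    by (intro zero_sum_covers_append zero_sum_covers_concat zero_sum_covers_4_6 zero_sum_covers_4_4)
  have "{x + 24..<x + 24 + 16 * int s} \<subseteq>
      (\<Union>k<s. {x + 24 + 16 * int k..<x + 24 + 16 * int k + 16})"
    by (rule interval_subset_Union_intervals) simp
  then show "{x..<x + (24 + 16 * int s)} \<subseteq>
    {x..<x + 24} \<union> (\<Union>k<s. {x + 24 + 16 * int k..<x + 24 + 16 * int k + 16})"
    unfolding add.assoc[symmetric] by (intro interval_append[OF Un_upper1] le_supI2)
qed

text \<open>Stacking arrays is placing their transposes side by side.\<close>

lemma zero_sum_covers_add_rows: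
  assumes "zero_sum_covers N m n S" "zero_sum_covers N m' n T"
  shows "zero_sum_covers N (m + m') n (S \<union> T)"
  by (rule zero_sum_covers_transpose[OF zero_sum_covers_append[OF
        assms[THEN zero_sum_covers_transpose]]])

lemma zero_sum_covers_4_rows:
  "zero_sum_covers N (t * 4) (6 + s * 4) {x..<x + (24 + 16 * int s) * int t}"
  by (rule zero_sum_covers_mono[OF zero_sum_covers_transpose[OF zero_sum_covers_concat[OF
          zero_sum_covers_transpose[OF zero_sum_covers_4_row]]]
        interval_subset_Union_intervals]) simp

text \<open>The gap \<open>{a..<b}\<close> left by the top rows has exactly as many elements as the
  \<open>t * 4\<close> new rows have cells, namely 4t(6 + 4s).\<close>

lemma zero_sum_covers_add_4_rows:
  assumes "zero_sum_covers N m (6 + s * 4) ({1..<a} \<union> {b..<c})"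
    and "b = a + (24 + 16 * int s) * int t"
  shows "zero_sum_covers N (m + t * 4) (6 + s * 4) {1..<c}"
proof (rule zero_sum_covers_mono)
  show "zero_sum_covers N (m + t * 4) (6 + s * 4) ({1..<a} \<union> {b..<c} \<union> {a..<b})"
    using zero_sum_covers_add_rows[OF assms(1) zero_sum_covers_4_rows[of N t s a]]
    by (simp only: assms(2))
  show "{1..<c} \<subseteq> {1..<a} \<union> {b..<c} \<union> {a..<b}"
    by auto
qed

theorem theorem9:
  fixes m n :: nat
  assumes "odd m" and "m \<ge> 3" and "n \<ge> 3" and "[n = 2] (mod 4)"
  shows "\<exists>A :: nat \<Rightarrow> nat \<Rightarrow> int. heffter_array m n A"
proof (rule heffter_array_if_zero_sum_covers)
  define M where "M = int (m * n)"
  have "n mod 4 = 2"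
    using assms(4) by (simp add: cong_def)
  then have "n = n div 4 * 4 + 2"
    by (metis div_mult_mod_eq)
  \<comment> \<open>The bound \<open>n \<ge> 3\<close> excludes \<open>n = 2\<close>, so one full 4
    can be joined to the remainder 2 to give the six columns of the core.\<close>
  moreover from this obtain s where "n div 4 = Suc s"
    using assms(3) by (cases "n div 4") auto
  ultimately have n: "n = 6 + s * 4"
    by simp
  have "m mod 4 = 3 \<or> m mod 4 = 1"
    using assms(1) by presburger
  then have "zero_sum_covers (2 * M + 1) m n {1..<M + 1}"
  proof
    assume "m mod 4 = 3"
    then obtain t where m: "m = 3 + t * 4"
      by (metis add.commute div_mult_mod_eq)
    show ?thesis
      unfolding n m
      \<comment> \<open>Since \<open>M\<close> is mn, the gap from 8s + 11 to M - 4s - 7 has length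
        M - 3n = 4tn.\<close>
      by (rule zero_sum_covers_add_4_rows[OF zero_sum_covers_3_rows])
        (simp add: M_def n m algebra_simps)
  next
    assume "m mod 4 = 1"
    then have "m = m div 4 * 4 + 1"
      by (metis div_mult_mod_eq)
    \<comment> \<open>Here \<open>m \<ge> 3\<close> excludes \<open>m = 1\<close>.\<close>
    moreover from this obtain t where "m div 4 = Suc t"
      using assms(2) by (cases "m div 4") auto
    ultimately have m: "m = 5 + t * 4"
      by simp
    show ?thesis
      unfolding n m
      by (rule zero_sum_covers_add_4_rows[OF zero_sum_covers_5_rows])
        (simp add: M_def n m algebra_simps)
  qed
  moreover have "{1..<M + 1} = {1..M}" by auto
  ultimately show "zero_sum_covers (2 * int (m * n) + 1) m n {1..int (m * n)}"
    by (simp add: M_def)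
qed

end
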